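(* Let $\Bbbk$ be an algebraically closed field of characteristic zero and let $A_{c,q}=\Bbbk[x,y,z]/(c(x)z-q(x,y))$ be a Danielewski-type algebra in reduced form with $\deg(c)\ge2$ and $\deg_y(q)\ge2$. Let $D\in\operatorname{Der}(A_{c,q})$ be a simple derivation. Then \[ \operatorname{Aut}_D(A_{c,q})\cap U_{\Bbbk}(A_{c,q})=\{\operatorname{id}\}. \]
   Context: Here $c(x)\in\Bbbk[x]$, and $q(x,y)\in\Bbbk[x,y]$ is quasi-monic in $y$, i.e. the coefficient of the highest power of $y$ is a unit (an element of $\Bbbk^*$). A polynomial of degree $m$ is centered if its coefficient in degree $m-1$ is zero. $A_{c,q}$ is in reduced form if $c(x)$ is centered, $q(x,y)$ is centered as a polynomial in $y$ over $\Bbbk[x]$, and $\deg_x(q)<\deg(c)$. $\bar x,\bar y,\bar z$ denote the images of $x,y,z$ in $A_{c,q}$. The standard locally nilpotent derivation $\xi_{c,q}$ of $A_{c,q}$ is given by $\xi_{c,q}(\bar x)=0$, $\xi_{c,q}(\bar y)=c(\bar x)$, $\xi_{c,q}(\bar z)=\partial_yq(\bar x,\bar y)$, and $U_{\Bbbk}(A_{c,q})=\{\exp(\ell(\bar x)\xi_{c,q})\mid \ell(x)\in\Bbbk[x]\}$, where $\exp(\eta)=\sum_{k\ge0}\eta^k/k!$. $\operatorname{Der}(A)$ is the space of $\Bbbk$-derivations of $A$; a derivation $D$ of $A$ is simple if the only ideals $I\subseteq A$ with $D(I)\subseteq I$ are $0$ and $A$; $\operatorname{Aut}_D(A)$ is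 the group of $\Bbbk$-algebra automorphisms $\sigma$ of $A$ with $\sigma D=D\sigma$. *)

theory Defs
  imports "HOL-Algebra.Algebraic_Closure_Type" "HOL-Algebra.Module" "HOL-Algebra.Bij"
begin

section \<open>Derivations and automorphisms of an algebra\<close>

text \<open>
  An algebra over the field formed by a type \<open>'k\<close> is a \<open>module\<close> record carrying the ring
  structure together with a scalar multiplication by elements of \<open>'k\<close>. Self-maps are kept
  extensional on the carrier, as in \<^theory>\<open>HOL-Algebra.Bij\<close>, so that equality of maps is
  equality of functions.
\<close>

definition Der :: "('k, 'a, 'm) module_scheme \<Rightarrow> ('a \<Rightarrow> 'a) set" where
  "Der A = {D \<in> carrier A \<rightarrow>\<^sub>E carrier A.
     (\<forall>a\<in>carrier A. \<forall>b\<in>carrier A. D (a \<oplus>\<^bsub>A\<^esub> b) = D a \<oplus>\<^bsub>A\<^esub> D b) \<and>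
     (\<forall>t. \<forall>a\<in>carrier A. D (t \<odot>\<^bsub>A\<^esub> a) = t \<odot>\<^bsub>A\<^esub> D a) \<and>
     (\<forall>a\<in>carrier A. \<forall>b\<in>carrier A.
        D (a \<otimes>\<^bsub>A\<^esub> b) = (D a \<otimes>\<^bsub>A\<^esub> b) \<oplus>\<^bsub>A\<^esub> (a \<otimes>\<^bsub>A\<^esub> D b))}"

definition simple_derivation :: "('k, 'a, 'm) module_scheme \<Rightarrow> ('a \<Rightarrow> 'a) \<Rightarrow> bool" where
  "simple_derivation A D \<longleftrightarrow> D \<in> Der A \<and>
     (\<forall>I. ideal I A \<and> D ` I \<subseteq> I \<longrightarrow> I = {\<zero>\<^bsub>A\<^esub>} \<or> I = carrier A)"

definition Alg_Aut :: "('k, 'a, 'm) module_scheme \<Rightarrow> ('a \<Rightarrow> 'a) set" where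
  "Alg_Aut A = {\<sigma> \<in> ring_hom A A \<inter> Bij (carrier A).
     \<forall>t. \<forall>a\<in>carrier A. \<sigma> (t \<odot>\<^bsub>A\<^esub> a) = t \<odot>\<^bsub>A\<^esub> \<sigma> a}"

definition Aut_Der :: "('k, 'a, 'm) module_scheme \<Rightarrow> ('a \<Rightarrow> 'a) \<Rightarrow> ('a \<Rightarrow> 'a) set" where
  "Aut_Der A D = {\<sigma> \<in> Alg_Aut A. compose (carrier A) \<sigma> D = compose (carrier A) D \<sigma>}"

text \<open>
  For locally nilpotent \<open>\<eta>\<close> only finitely many terms of the exponential series at a given
  element are nonzero, and the sum below runs over exactly those.
\<close>

definition exp_der :: "('k::field_char_0, 'a, 'm) module_scheme \<Rightarrow> ('a \<Rightarrow> 'a) \<Rightarrow> 'a \<Rightarrow> 'a" where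
  "exp_der A \<eta> = (\<lambda>a\<in>carrier A.
     \<Oplus>\<^bsub>A\<^esub> k \<in> {k. (\<eta> ^^ k) a \<noteq> \<zero>\<^bsub>A\<^esub>}. (1 / fact k) \<odot>\<^bsub>A\<^esub> (\<eta> ^^ k) a)"


section \<open>Danielewski-type algebras\<close>

text \<open>
  The polynomial rings in \<open>x\<close>, in \<open>x, y\<close> and in \<open>x, y, z\<close> are the iterated ones
  \<open>'k poly\<close>, \<open>'k poly poly\<close> and \<open>'k poly poly poly\<close>, the last adjoined variable being the
  outermost. So, for \<open>q\<close> in \<open>'k poly poly\<close>, \<open>degree q\<close> is its degree in \<open>y\<close> and
  \<open>pderiv q\<close> its partial derivative with respect to \<open>y\<close>.
\<close>

definition deg_x :: "'k::zero poly poly \<Rightarrow> nat" where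
  "deg_x q = Max ((\<lambda>i. degree (Polynomial.coeff q i)) ` {..degree q})"

definition quasi_monic :: "'k::zero poly poly \<Rightarrow> bool" where
  "quasi_monic q \<longleftrightarrow> (\<exists>u. u \<noteq> 0 \<and> lead_coeff q = [:u:])"

definition centered :: "'a::zero poly \<Rightarrow> bool" where
  "centered p \<longleftrightarrow> (degree p > 0 \<longrightarrow> Polynomial.coeff p (degree p - 1) = 0)"

definition reduced_form :: "'k::zero poly \<Rightarrow> 'k poly poly \<Rightarrow> bool" where
  "reduced_form c q \<longleftrightarrow> centered c \<and> centered q \<and> deg_x q < degree c"

text \<open>The ideal generated by \<open>c(x) z - q(x,y)\<close> in the polynomial ring in \<open>x, y, z\<close>.\<close>

definition dan_ideal :: "'k::field poly \<Rightarrow> 'k poly poly \<Rightarrow> 'k poly poly poly set" where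
  "dan_ideal c q = PIdl\<^bsub>ring_of_type_algebra\<^esub> ([:[:c:]:] * [:0, 1:] - [:q:])"

definition dan_cls :: "'k::field poly \<Rightarrow> 'k poly poly \<Rightarrow> 'k poly poly poly \<Rightarrow> 'k poly poly poly set" where
  "dan_cls c q f = dan_ideal c q +>\<^bsub>ring_of_type_algebra\<^esub> f"

definition dan_alg :: "'k::field poly \<Rightarrow> 'k poly poly \<Rightarrow> ('k, 'k poly poly poly set) module" where
  "dan_alg c q = (let Q = ring_of_type_algebra Quot dan_ideal c q in
     ring.extend Q (module.fields (\<lambda>t a. dan_cls c q [:[:[:t:]:]:] \<otimes>\<^bsub>Q\<^esub> a)))"

definition dan_x :: "'k::field poly \<Rightarrow> 'k poly poly \<Rightarrow> 'k poly poly poly set" where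
  "dan_x c q = dan_cls c q [:[:[:0, 1:]:]:]"

definition dan_y :: "'k::field poly \<Rightarrow> 'k poly poly \<Rightarrow> 'k poly poly poly set" where
  "dan_y c q = dan_cls c q [:[:0, 1:]:]"

definition dan_z :: "'k::field poly \<Rightarrow> 'k poly poly \<Rightarrow> 'k poly poly poly set" where
  "dan_z c q = dan_cls c q [:0, 1:]"

definition is_std_lnd ::
  "'k::field poly \<Rightarrow> 'k poly poly \<Rightarrow> ('k poly poly poly set \<Rightarrow> 'k poly poly poly set) \<Rightarrow> bool" where
  "is_std_lnd c q \<xi> \<longleftrightarrow> \<xi> \<in> Der (dan_alg c q) \<and>
     \<xi> (dan_x c q) = \<zero>\<^bsub>dan_alg c q\<^esub> \<and>
     \<xi> (dan_y c q) = dan_cls c q [:[:c:]:] \<and>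
     \<xi> (dan_z c q) = dan_cls c q [:pderiv q:]"

text \<open>The description is definite: see \<open>ex1_std_lnd\<close> below.\<close>

definition std_lnd ::
  "'k::field poly \<Rightarrow> 'k poly poly \<Rightarrow> 'k poly poly poly set \<Rightarrow> 'k poly poly poly set" where
  "std_lnd c q = (THE \<xi>. is_std_lnd c q \<xi>)"

definition dan_U ::
  "'k::field_char_0 poly \<Rightarrow> 'k poly poly \<Rightarrow> ('k poly poly poly set \<Rightarrow> 'k poly poly poly set) set" where
  "dan_U c q = {exp_der (dan_alg c q)
      (\<lambda>a\<in>carrier (dan_alg c q). dan_cls c q [:[:l:]:] \<otimes>\<^bsub>dan_alg c q\<^esub> std_lnd c q a) | l. True}"


section \<open>Well-definedness\<close>

lemma dan_ideal_is_ideal: "ideal (dan_ideal c q) ring_of_type_algebra"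
  unfolding dan_ideal_def
  by (rule cring.cgenideal_ideal[OF cring_from_type_algebra]) (simp add: ring_of_type_algebra_def)

lemma dan_ideal_eq: "dan_ideal c q = {h * ([:[:c:]:] * [:0, 1:] - [:q:]) | h. True}"
  by (simp add: dan_ideal_def cgenideal_def ring_of_type_algebra_def)

lemma dan_alg_simps:
  "carrier (dan_alg c q) = range (dan_cls c q)"
  "dan_cls c q f \<oplus>\<^bsub>dan_alg c q\<^esub> dan_cls c q g = dan_cls c q (f + g)"
  "dan_cls c q f \<otimes>\<^bsub>dan_alg c q\<^esub> dan_cls c q g = dan_cls c q (f * g)"
  "\<zero>\<^bsub>dan_alg c q\<^esub> = dan_cls c q 0"
  "\<one>\<^bsub>dan_alg c q\<^esub> = dan_cls c q 1"
  "t \<odot>\<^bsub>dan_alg c q\<^esub> dan_cls c q g = dan_cls c q ([:[:[:t:]:]:] * g)"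
proof -
  interpret ideal "dan_ideal c q" "ring_of_type_algebra :: 'a poly poly poly ring"
    by (rule dan_ideal_is_ideal)
  have sel: "carrier (ring_of_type_algebra :: 'a poly poly poly ring) = UNIV"
    "add (ring_of_type_algebra :: 'a poly poly poly ring) = (+)"
    "monoid.mult (ring_of_type_algebra :: 'a poly poly poly ring) = (*)"
    "\<zero>\<^bsub>ring_of_type_algebra :: 'a poly poly poly ring\<^esub> = 0"
    "\<one>\<^bsub>ring_of_type_algebra :: 'a poly poly poly ring\<^esub> = 1"
    by (simp_all add: ring_of_type_algebra_def)
  note d = dan_alg_def Let_def ring.defs module.defs FactRing_def dan_cls_def
  show "carrier (dan_alg c q) = range (dan_cls c q)"
    by (auto simp: d A_RCOSETS_defs a_r_coset_def sel)
  show "dan_cls c q f \<oplus>\<^bsub>dan_alg c q\<^esub> dan_cls c q g = dan_cls c q (f + g)"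
    using a_rcos_sum[of f g] by (simp add: d sel)
  show "dan_cls c q f \<otimes>\<^bsub>dan_alg c q\<^esub> dan_cls c q g = dan_cls c q (f * g)"
    using rcoset_mult_add[of f g] by (simp add: d sel)
  show "t \<odot>\<^bsub>dan_alg c q\<^esub> dan_cls c q g = dan_cls c q ([:[:[:t:]:]:] * g)"
    using rcoset_mult_add[of "[:[:[:t:]:]:]" g] by (simp add: d sel)
  show "\<zero>\<^bsub>dan_alg c q\<^esub> = dan_cls c q 0"
    using a_rcos_zero[OF ideal_axioms, of 0] zeropideal sel
    by (simp add: d sel a_r_coset_def r_coset_def)
  show "\<one>\<^bsub>dan_alg c q\<^esub> = dan_cls c q 1"
    by (simp add: d sel)
qed

lemma dan_cls_eq_iff: "dan_cls c q f = dan_cls c q g \<longleftrightarrow> f - g \<in> dan_ideal c q"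
proof -
  interpret ideal "dan_ideal c q" "ring_of_type_algebra :: 'a poly poly poly ring"
    by (rule dan_ideal_is_ideal)
  have *: "dan_cls c q f = {i + f | i. i \<in> dan_ideal c q}" for f
    by (auto simp: dan_cls_def a_r_coset_def r_coset_def ring_of_type_algebra_def)
  have z: "0 \<in> dan_ideal c q" unfolding dan_ideal_eq by (auto intro: exI[of _ 0])
  have add: "a + b \<in> dan_ideal c q" if ab: "a \<in> dan_ideal c q" "b \<in> dan_ideal c q" for a b
  proof -
    obtain h k where "a = h * ([:[:c:]:] * [:0, 1:] - [:q:])" "b = k * ([:[:c:]:] * [:0, 1:] - [:q:])"
      using ab unfolding dan_ideal_eq by blast
    then have "a + b = (h + k) * ([:[:c:]:] * [:0, 1:] - [:q:])" by (simp only: distrib_right)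
    then show ?thesis unfolding dan_ideal_eq by blast
  qed
  have neg: "- a \<in> dan_ideal c q" if "a \<in> dan_ideal c q" for a
    using that unfolding dan_ideal_eq mem_Collect_eq by (metis minus_mult_left)
  show ?thesis
  proof
    assume "dan_cls c q f = dan_cls c q g"
    then have "0 + f \<in> {i + g | i. i \<in> dan_ideal c q}" using z unfolding * by blast
    then show "f - g \<in> dan_ideal c q" by auto
  next
    assume fg: "f - g \<in> dan_ideal c q"
    show "dan_cls c q f = dan_cls c q g"
    proof (intro equalityI subsetI)
      fix h assume "h \<in> dan_cls c q f"
      then obtain i where i: "i \<in> dan_ideal c q" "h = i + f" unfolding * by blast
      then show "h \<in> dan_cls c q g" using add[OF i(1) fg] unfolding *
        by (auto intro!: exI[of _ "i + (f - g)"])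
    next
      fix h assume "h \<in> dan_cls c q g"
      then obtain i where i: "i \<in> dan_ideal c q" "h = i + g" unfolding * by blast
      then show "h \<in> dan_cls c q f" using add[OF i(1) neg[OF fg]] unfolding *
        by (auto intro!: exI[of _ "i + - (f - g)"])
    qed
  qed
qed

lemma algebra_dan_alg: "algebra ring_of_type_algebra (dan_alg c q)"
proof -
  have 1: "abelian_group (dan_alg c q)"
  proof (rule abelian_groupI)
    fix a assume "a \<in> carrier (dan_alg c q)"
    then obtain f where "a = dan_cls c q f" by (auto simp: dan_alg_simps(1))
    then have "dan_cls c q (- f) \<oplus>\<^bsub>dan_alg c q\<^esub> a = \<zero>\<^bsub>dan_alg c q\<^esub>"
      by (simp only: dan_alg_simps) simp
    then show "\<exists>b\<in>carrier (dan_alg c q). b \<oplus>\<^bsub>dan_alg c q\<^esub> a = \<zero>\<^bsub>dan_alg c q\<^esub>"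
      by (auto simp: dan_alg_simps(1))
  qed (auto simp: dan_alg_simps add_ac)
  have 2: "cring (dan_alg c q)"
    by (rule cringI[OF 1 comm_monoidI]) (auto simp: dan_alg_simps mult_ac distrib_left)
  have e: "[:[:[:s + t:]:]:] * f = [:[:[:s:]:]:] * f + [:[:[:t:]:]:] * f"
    "[:[:[:s * t:]:]:] * f = [:[:[:s:]:]:] * ([:[:[:t:]:]:] * f)"
    "[:[:[:1:]:]:] * f = f" for s t :: 'a and f
    by (simp_all add: mult.commute[of s t] flip: smult_add_left one_pCons)
  have sel: "a \<oplus>\<^bsub>ring_of_type_algebra\<^esub> b = a + b"
    "a \<otimes>\<^bsub>ring_of_type_algebra\<^esub> b = a * b" "\<one>\<^bsub>ring_of_type_algebra\<^esub> = (1::'a)"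
    for a b :: 'a
    by (simp_all add: ring_of_type_algebra_def)
  show ?thesis
    by (rule algebraI[OF cring_from_type_algebra 2])
      (auto simp: dan_alg_simps sel e distrib_left mult.assoc
        simp del: mult_pCons_left mult_pCons_right)
qed

lemma map_poly_pderiv_add: "map_poly pderiv (f + g) = map_poly pderiv f + map_poly pderiv g"
  by (rule poly_eqI) (simp add: coeff_map_poly pderiv_add)

lemma map_poly_pderiv_mult:
  fixes f g :: "'a::idom poly poly"
  shows "map_poly pderiv (f * g) = map_poly pderiv f * g + f * map_poly pderiv g"
proof (rule poly_eqI)
  have ps: "pderiv (sum h T) = (\<Sum>i\<in>T. pderiv (h i))" if "finite T" for h :: "nat \<Rightarrow> 'a poly" and T
    using that by induction (auto simp: pderiv_add)
  have pm: "pderiv (a * b) = pderiv a * b + a * pderiv b" for a b :: "'a poly"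
    by (simp add: pderiv_mult mult.commute add.commute)
  show "Polynomial.coeff (map_poly pderiv (f * g)) n
    = Polynomial.coeff (map_poly pderiv f * g + f * map_poly pderiv g) n" for n
    by (simp add: coeff_map_poly coeff_mult ps pm sum.distrib)
qed

definition lift_der ::
  "'k::field poly \<Rightarrow> 'k poly poly \<Rightarrow> 'k poly poly poly \<Rightarrow> 'k poly poly poly" where
  "lift_der c q f = [:[:c:]:] * map_poly pderiv f + [:pderiv q:] * pderiv f"

lemma lift_der_add: "lift_der c q (f + g) = lift_der c q f + lift_der c q g"
  by (simp only: lift_der_def map_poly_pderiv_add pderiv_add) (simp only: algebra_simps)

lemma lift_der_mult: "lift_der c q (f * g) = lift_der c q f * g + f * lift_der c q g"
  by (simp only: lift_der_def map_poly_pderiv_mult pderiv_mult) (simp only: algebra_simps)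

lemma lift_der_const: "lift_der c q [:[:p:]:] = 0"
  by (simp add: lift_der_def map_poly_pCons)

lemma lift_der_ideal:
  assumes "f \<in> dan_ideal c q"
  shows "lift_der c q f \<in> dan_ideal c q"
proof -
  let ?F = "[:[:c:]:] * [:0, 1:] - [:q:] :: 'a poly poly poly"
  obtain h where h: "f = h * ?F" using assms unfolding dan_ideal_eq by blast
  have "lift_der c q ?F = 0"
    by (simp add: lift_der_def map_poly_pCons pderiv_pCons pderiv_minus)
  then have "lift_der c q f = lift_der c q h * ?F" by (simp only: h lift_der_mult) simp
  then show ?thesis unfolding dan_ideal_eq by blast
qed

lemma Der_agree:
  assumes D: "D \<in> Der (dan_alg c q)" and E: "E \<in> Der (dan_alg c q)"
    and x: "D (dan_x c q) = E (dan_x c q)"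
    and y: "D (dan_y c q) = E (dan_y c q)"
    and z: "D (dan_z c q) = E (dan_z c q)"
  shows "D = E"
proof -
  let ?A = "dan_alg c q" and ?k = "dan_cls c q"
  have Dadd: "D (?k (f + g)) = D (?k f) \<oplus>\<^bsub>?A\<^esub> D (?k g)"
    and Dmult: "D (?k (f * g)) = (D (?k f) \<otimes>\<^bsub>?A\<^esub> ?k g) \<oplus>\<^bsub>?A\<^esub> (?k f \<otimes>\<^bsub>?A\<^esub> D (?k g))"
    and Dsc: "D (?k ([:[:[:t:]:]:] * f)) = t \<odot>\<^bsub>?A\<^esub> D (?k f)"
    and Dcl: "\<exists>h. D (?k f) = ?k h"
    if "D \<in> Der ?A" for D f g t
  proof -
    have c: "?k h \<in> carrier ?A" for h by (simp add: dan_alg_simps)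
    have "D (?k f) \<in> carrier ?A" using that c by (auto simp: Der_def)
    then show "\<exists>h. D (?k f) = ?k h" by (auto simp: dan_alg_simps(1))
    show "D (?k (f + g)) = D (?k f) \<oplus>\<^bsub>?A\<^esub> D (?k g)"
      "D (?k (f * g)) = (D (?k f) \<otimes>\<^bsub>?A\<^esub> ?k g) \<oplus>\<^bsub>?A\<^esub> (?k f \<otimes>\<^bsub>?A\<^esub> D (?k g))"
      using that c[of f] c[of g] unfolding dan_alg_simps(2,3,6)[symmetric] Der_def by blast+
    show "D (?k ([:[:[:t:]:]:] * f)) = t \<odot>\<^bsub>?A\<^esub> D (?k f)"
      using that c[of f] unfolding dan_alg_simps(6)[symmetric] Der_def by blast
  qed
  have one: "D (?k 1) = ?k 0" if d: "D \<in> Der ?A" for D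
  proof -
    obtain h where h: "D (?k 1) = ?k h" using Dcl[OF d] by blast
    have "?k h = ?k (h + h)" using Dmult[OF d, of 1 1] by (simp add: h dan_alg_simps)
    then have "- h \<in> dan_ideal c q" by (simp add: dan_cls_eq_iff)
    then have "0 - (- h) \<in> dan_ideal c q" unfolding dan_ideal_eq mem_Collect_eq
      by (metis diff_0 minus_mult_left)
    then show ?thesis by (simp add: h dan_cls_eq_iff)
  qed
  define S where "S = {f. D (?k f) = E (?k f)}"
  have add: "f + g \<in> S" and mult: "f * g \<in> S" if "f \<in> S" "g \<in> S" for f g
    using that D E by (simp_all add: S_def Dadd Dmult)
  have const: "[:[:[:t:]:]:] \<in> S" for t
    using Dsc[OF D, of t 1] Dsc[OF E, of t 1] one[OF D] one[OF E] by (simp add: S_def)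
  have X: "[:[:[:0, 1:]:]:] \<in> S" and Y: "[:[:0, 1:]:] \<in> S" and Z: "[:0, 1:] \<in> S"
    using x y z by (simp_all add: S_def dan_x_def dan_y_def dan_z_def)
  have px: "[:[:p:]:] \<in> S" for p
  proof (induction p)
    case 0 then show ?case using const[of 0] by simp
  next
    case (pCons a p)
    have "[:[:pCons a p:]:] = [:[:[:a:]:]:] + [:[:[:0, 1:]:]:] * [:[:p:]:]" by simp
    then show ?case using add[OF const[of a] mult[OF X pCons.IH]] by metis
  qed
  have py: "[:p:] \<in> S" for p
  proof (induction p)
    case 0 then show ?case using const[of 0] by simp
  next
    case (pCons a p)
    have "[:pCons a p:] = [:[:a:]:] + [:[:0, 1:]:] * [:p:]" by simp
    then show ?case using add[OF px[of a] mult[OF Y pCons.IH]] by metis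
  qed
  have pz: "p \<in> S" for p
  proof (induction p)
    case 0 then show ?case using const[of 0] by simp
  next
    case (pCons a p)
    have "pCons a p = [:a:] + [:0, 1:] * p" by simp
    then show ?case using add[OF py[of a] mult[OF Z pCons.IH]] by metis
  qed
  show ?thesis
  proof
    fix a
    show "D a = E a"
    proof (cases "a \<in> carrier ?A")
      case True
      then show ?thesis using pz by (auto simp: dan_alg_simps S_def)
    next
      case False
      have "D \<in> carrier ?A \<rightarrow>\<^sub>E carrier ?A"
        using D unfolding Der_def mem_Collect_eq by (rule conjunct1)
      moreover have "E \<in> carrier ?A \<rightarrow>\<^sub>E carrier ?A"
        using E unfolding Der_def mem_Collect_eq by (rule conjunct1)
      ultimately show ?thesis using PiE_arb[OF _ False] by metis
    qed
  qed
qed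

lemma ex1_std_lnd: "\<exists>!\<xi>. is_std_lnd c q \<xi>"
proof -
  let ?A = "dan_alg c q" and ?k = "dan_cls c q"
  define \<xi> where "\<xi> = (\<lambda>a\<in>carrier ?A. ?k (lift_der c q (SOME f. a = ?k f)))"
  have val: "\<xi> (?k f) = ?k (lift_der c q f)" for f
  proof -
    define g where "g = (SOME g. ?k f = ?k g)"
    have "?k f = ?k g" unfolding g_def by (rule someI[of _ f]) simp
    then have "f - g \<in> dan_ideal c q" by (simp add: dan_cls_eq_iff)
    from lift_der_ideal[OF this] have "lift_der c q (f - g) \<in> dan_ideal c q" .
    moreover have "lift_der c q (f - g) = lift_der c q f - lift_der c q g"
      using lift_der_add[of c q "f - g" g] by simp
    ultimately have "?k (lift_der c q f) = ?k (lift_der c q g)" by (simp add: dan_cls_eq_iff)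
    then show ?thesis by (simp add: \<xi>_def dan_alg_simps(1) g_def)
  qed
  have "\<xi> \<in> Der ?A"
    unfolding Der_def
    by (auto simp: dan_alg_simps val lift_der_add lift_der_mult lift_der_const
      simp del: mult_pCons_left) (auto simp: \<xi>_def dan_alg_simps)
  then have "is_std_lnd c q \<xi>"
    by (auto simp: is_std_lnd_def dan_x_def dan_y_def dan_z_def val dan_alg_simps lift_der_const)
      (simp_all add: lift_der_def map_poly_pCons pderiv_pCons)
  then show ?thesis by (auto simp: is_std_lnd_def intro!: ex1I[of _ \<xi>] Der_agree)
qed

end

theory Submission
  imports Defs "HOL-Computational_Algebra.Polynomial_Factorial"
begin

text \<open>
  Write \<open>A\<close> for the algebra and \<open>K = k(x)\<close>. Inverting \<open>c\<close> makes \<open>z = q/c\<close> redundant, so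
  \<open>A\<close> maps to \<open>K[Y]\<close>. There the standard derivation becomes \<open>c \<partial>/\<partial>Y\<close>, and
  \<open>\<sigma> = exp(l \<xi>)\<close> becomes the translation \<open>Y \<mapsto> Y + s\<close> with \<open>s = l c\<close>
  (\<open>exp_scaled_lnd\<close>). The second ingredient is that, \<open>q\<close> being quasi-monic, elements of \<open>A\<close>
  have a normal form whose image degree can be read off. It follows that \<open>A\<close> embeds in
  \<open>K[Y]\<close> and that an element of degree below \<open>deg\<^sub>y q\<close> is represented by a polynomial
  in \<open>k[x,y]\<close>: no denominators occur in low degree (\<open>emb_low_degree\<close>).

  Suppose now that \<open>l \<noteq> 0\<close> and that \<open>\<sigma>\<close> commutes with a simple derivation \<open>D\<close>. Since
  \<open>\<sigma>\<close> fixes \<open>x\<close>, it fixes \<open>D x\<close>; a polynomial invariant under a nontrivial translation in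
  characteristic zero is constant, so \<open>D x = p(x)\<close> with \<open>p \<in> k[x]\<close>. A root \<open>r\<close> of \<open>p\<close>
  would make the proper ideal \<open>(x - r)\<close> stable under \<open>D\<close> (\<open>simple_derivation_x\<close>), so \<open>p\<close> is
  a nonzero constant \<open>\<mu>\<close>. Applying \<open>D\<close> to \<open>\<sigma> y = y + s\<close> gives
  \<open>\<sigma>(D y) = D y + \<mu> s'\<close>, where \<open>s' \<noteq> 0\<close> because \<open>c\<close> is not constant. A polynomial
  that a translation by \<open>s\<close> changes by a nonzero constant has degree one in \<open>Y\<close>, and its
  leading coefficient \<open>\<alpha>\<close> satisfies \<open>\<alpha> s = \<mu> s'\<close>. As \<open>deg\<^sub>y q \<ge> 2\<close>, the coefficient
  \<open>\<alpha>\<close> lies in \<open>k[x]\<close>, so \<open>s\<close> divides the nonzero polynomial \<open>\<mu> s'\<close> of smaller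
  degree, a contradiction.
\<close>


section \<open>Inverting c\<close>

text \<open>The substitution \<open>z := q/c\<close>, carried out in \<open>K[Y]\<close>.\<close>

definition localize :: "'k::field_char_0 poly \<Rightarrow> 'k poly poly \<Rightarrow> 'k poly poly poly \<Rightarrow> 'k poly fract poly" where
  "localize c q f = poly (map_poly fract_poly f) (smult (inverse (to_fract c)) (fract_poly q))"

lemma localize_pCons:
  "localize c q (pCons a f)
    = fract_poly a + smult (inverse (to_fract c)) (fract_poly q) * localize c q f"
  by (simp add: localize_def map_poly_pCons)

lemma localize_0 [simp]: "localize c q 0 = 0"
  by (simp add: localize_def)

lemma localize_const [simp]: "localize c q [:a:] = fract_poly a"
  by (simp add: localize_pCons)

lemma localize_add: "localize c q (f + g) = localize c q f + localize c q g"
  by (induction f g rule: poly_induct2) (simp_all add: localize_pCons algebra_simps)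

lemma localize_smult: "localize c q (smult a f) = fract_poly a * localize c q f"
  by (induction f) (simp_all add: localize_pCons algebra_simps)

lemma localize_mult: "localize c q (f * g) = localize c q f * localize c q g"
  by (induction f) (simp_all add: localize_pCons localize_add localize_smult algebra_simps)


section \<open>Translations of polynomials in characteristic zero\<close>

text \<open>
  By Taylor's formula this is \<open>g(Y + t)\<close>. The expansion is taken as the definition because it
  is the form in which the exponential series delivers it, and its first two terms are all
  that is needed below.
\<close>

definition taylor_shift :: "'k::field_char_0 poly fract \<Rightarrow> 'k poly fract poly \<Rightarrow> 'k poly fract poly" where
  "taylor_shift t g = (\<Sum>k\<le>degree g. smult (to_fract [:1 / fact k:] * t ^ k) ((pderiv ^^ k) g))"

lemma higher_pderiv_eq_0: "degree g < k \<Longrightarrow> (pderiv ^^ k) g = 0"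
  for g :: "'a::idom poly"
  by (intro poly_eqI) (simp add: coeff_higher_pderiv coeff_eq_0)

lemma to_fract_const_1 [simp]: "to_fract [:1::'k::field:] = 1"
  by (metis one_pCons to_fract_1)

lemma taylor_shift_const: "degree g = 0 \<Longrightarrow> taylor_shift t g = g"
  by (simp add: taylor_shift_def)

lemma taylor_shift_0: "taylor_shift 0 g = g"
proof -
  have "taylor_shift 0 g = (\<Sum>k\<le>degree g. if k = 0 then g else 0)"
    unfolding taylor_shift_def by (intro sum.cong) auto
  then show ?thesis by simp
qed

text \<open>Taylor terms of order at least two do not reach the degree \<open>degree g - 1\<close>.\<close>

lemma coeff_taylor_shift_diff:
  assumes "degree g > 0"
  shows "Polynomial.coeff (taylor_shift t g - g) (degree g - 1) = t * of_nat (degree g) * lead_coeff g"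
proof -
  obtain m where m: "degree g = Suc m" using assms gr0_implies_Suc by blast
  have "taylor_shift t g - g =
     smult t (pderiv g) + (\<Sum>k=2..Suc m. smult (to_fract [:1 / fact k:] * t ^ k) ((pderiv ^^ k) g))"
    unfolding taylor_shift_def m atMost_atLeast0
    by (simp add: sum.atLeast_Suc_atMost numeral_2_eq_2 del: sum.cl_ivl_Suc)
  moreover have "Polynomial.coeff (\<Sum>k=2..Suc m. smult (to_fract [:1 / fact k:] * t ^ k) ((pderiv ^^ k) g)) m = 0"
    unfolding coeff_sum by (intro sum.neutral) (auto simp: coeff_higher_pderiv coeff_eq_0 m)
  ultimately show ?thesis using m by (simp add: coeff_pderiv)
qed

lemma of_nat_fract_neq_0:
  assumes "n > 0" shows "(of_nat n :: 'k::field_char_0 poly fract) \<noteq> 0"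
proof -
  have "(of_nat n :: 'k poly fract) = to_fract (of_nat n)" by (induction n) simp_all
  then show ?thesis using assms by (simp add: of_nat_poly)
qed

lemma degree_taylor_shift_fixed:
  assumes "t \<noteq> 0" and "taylor_shift t g = g"
  shows "degree g = 0"
proof (rule ccontr)
  assume "degree g \<noteq> 0"
  with coeff_taylor_shift_diff[of g t] assms of_nat_fract_neq_0[of "degree g", where 'k='a]
  show False by auto
qed

lemma taylor_shift_translated:
  assumes "t \<noteq> 0" "s \<noteq> 0" and eq: "taylor_shift t g = g + [:s:]"
  shows "degree g = 1" and "t * Polynomial.coeff g 1 = s"
proof -
  have pos: "degree g > 0" using taylor_shift_const[of g t] assms by (cases "degree g = 0") auto
  have diff: "Polynomial.coeff [:s:] (degree g - 1) = t * of_nat (degree g) * lead_coeff g"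
    using coeff_taylor_shift_diff[OF pos, of t] by (simp add: eq)
  moreover have "t * of_nat (degree g) * lead_coeff g \<noteq> 0"
    using of_nat_fract_neq_0[OF pos, where 'k='a] \<open>t \<noteq> 0\<close> pos by auto
  ultimately have "degree g - 1 = 0" by (auto simp: coeff_pCons split: nat.splits)
  then show "degree g = 1" using pos by simp
  then show "t * Polynomial.coeff g 1 = s" using diff by simp
qed


section \<open>Embedding the algebra into polynomials over the rational functions\<close>

lemma poly3_induct [case_names const x y z add mult]:
  assumes const: "\<And>t. P [:[:[:t:]:]:]"
    and x: "P [:[:[:0, 1:]:]:]" and y: "P [:[:0, 1:]:]" and z: "P [:0, 1:]"
    and add: "\<And>f g. P f \<Longrightarrow> P g \<Longrightarrow> P (f + g)"
    and mult: "\<And>f g. P f \<Longrightarrow> P g \<Longrightarrow> P (f * g)"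
  shows "P (f :: 'a::comm_ring_1 poly poly poly)"
proof -
  have kx: "P [:[:p:]:]" for p
  proof (induction p)
    case 0 then show ?case using const[of 0] by simp
  next
    case (pCons a p)
    have "[:[:pCons a p:]:] = [:[:[:a:]:]:] + [:[:[:0, 1:]:]:] * [:[:p:]:]" by simp
    then show ?case using add[OF const[of a] mult[OF x pCons.IH]] by metis
  qed
  have kxy: "P [:p:]" for p
  proof (induction p)
    case 0 then show ?case using const[of 0] by simp
  next
    case (pCons a p)
    have "[:pCons a p:] = [:[:a:]:] + [:[:0, 1:]:] * [:p:]" by simp
    then show ?case using add[OF kx[of a] mult[OF y pCons.IH]] by metis
  qed
  show ?thesis
  proof (induction f)
    case 0 then show ?case using const[of 0] by simp
  next
    case (pCons a p)
    have "pCons a p = [:a:] + [:0, 1:] * p" by simp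
    then show ?case using add[OF kxy[of a] mult[OF z pCons.IH]] by metis
  qed
qed

locale danielewski =
  fixes c :: "'k::field_char_0 poly" and q :: "'k poly poly"
  assumes c_nonzero: "c \<noteq> 0" and quasi_monic: "quasi_monic q" and degree_q: "degree q > 0"
begin

abbreviation "A \<equiv> dan_alg c q"
abbreviation "cl \<equiv> dan_cls c q"

sublocale A: cring A
  using algebra_dan_alg by (rule algebra.axioms(2))

lemma cl_closed [simp]: "cl f \<in> carrier A"
  by (simp add: dan_alg_simps)

lemma localize_ideal: "f \<in> dan_ideal c q \<Longrightarrow> localize c q f = 0"
proof -
  have "localize c q ([:[:c:]:] * [:0, 1:] - [:q:]) + localize c q [:q:] = localize c q ([:[:c:]:] * [:0, 1:])"
    by (simp only: localize_add[symmetric] diff_add_cancel)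
  also have "\<dots> = localize c q [:q:]"
    using c_nonzero by (simp add: localize_pCons map_poly_pCons)
  finally have zero: "localize c q ([:[:c:]:] * [:0, 1:] - [:q:]) = 0"
    by (metis add_cancel_left_left)
  assume "f \<in> dan_ideal c q"
  then obtain h where "f = h * ([:[:c:]:] * [:0, 1:] - [:q:])" unfolding dan_ideal_eq by blast
  then show ?thesis by (simp only: localize_mult zero mult_zero_right)
qed

lemma localize_cong:
  assumes "cl f = cl g" shows "localize c q f = localize c q g"
proof -
  have "f - g \<in> dan_ideal c q" using assms by (simp add: dan_cls_eq_iff)
  then have "localize c q (f - g) = 0" by (rule localize_ideal)
  then show ?thesis using localize_add[of c q "f - g" g] by simp
qed

definition emb where "emb a = localize c q (SOME f. a = cl f)"

lemma emb_cl: "emb (cl f) = localize c q f"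
  unfolding emb_def by (rule localize_cong, rule sym, rule someI[of _ f]) simp

lemma carrier_cases: "a \<in> carrier A \<Longrightarrow> (\<And>f. a = cl f \<Longrightarrow> P) \<Longrightarrow> P"
  by (auto simp: dan_alg_simps)

lemma emb_add: "a \<in> carrier A \<Longrightarrow> b \<in> carrier A \<Longrightarrow> emb (a \<oplus>\<^bsub>A\<^esub> b) = emb a + emb b"
  by (elim carrier_cases) (simp add: dan_alg_simps emb_cl localize_add)

lemma emb_mult: "a \<in> carrier A \<Longrightarrow> b \<in> carrier A \<Longrightarrow> emb (a \<otimes>\<^bsub>A\<^esub> b) = emb a * emb b"
  by (elim carrier_cases) (simp add: dan_alg_simps emb_cl localize_mult)

lemma emb_scale: "a \<in> carrier A \<Longrightarrow> emb (r \<odot>\<^bsub>A\<^esub> a) = smult (to_fract [:r:]) (emb a)"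
  by (elim carrier_cases)
    (simp add: dan_alg_simps emb_cl localize_mult map_poly_pCons del: mult_pCons_left mult_pCons_right; simp)

lemma scale_closed: "a \<in> carrier A \<Longrightarrow> r \<odot>\<^bsub>A\<^esub> a \<in> carrier A"
  by (elim carrier_cases) (simp add: dan_alg_simps(6))

lemma emb_zero: "emb \<zero>\<^bsub>A\<^esub> = 0"
  by (simp add: dan_alg_simps emb_cl)

text \<open>
  Since \<open>q = c z\<close> in the algebra and \<open>q\<close> is quasi-monic, \<open>y\<close> to the power \<open>degree q\<close> can be
  traded for \<open>c z\<close>; what remains are polynomials in \<open>z\<close> whose coefficients have low degree in
  \<open>y\<close>. Mapped to \<open>K[Y]\<close>, nonzero terms in different powers of \<open>z\<close> have different degrees,
  so they cannot cancel.
\<close>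

definition is_normal where "is_normal N \<longleftrightarrow> (\<forall>i. degree (Polynomial.coeff N i) < degree q)"

lemma normal_add: "is_normal M \<Longrightarrow> is_normal N \<Longrightarrow> is_normal (M + N)"
  by (auto simp: is_normal_def intro: degree_add_less)

lemma normal_pCons: "is_normal (pCons a N) \<longleftrightarrow> degree a < degree q \<and> is_normal N"
  by (force simp: is_normal_def coeff_pCons split: nat.splits)

lemma normal_const: "degree a < degree q \<Longrightarrow> is_normal [:a:]"
  using degree_q by (simp add: normal_pCons) (simp add: is_normal_def)

lemma normal_smult: "is_normal N \<Longrightarrow> is_normal (smult [:s:] N)"
  by (auto simp: is_normal_def intro: le_less_trans[OF degree_smult_le])

lemma normal_shift: "is_normal N \<Longrightarrow> is_normal (pCons 0 N)"
  using degree_q by (simp add: normal_pCons)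

lemma cl_add_cong: "cl f = cl f' \<Longrightarrow> cl g = cl g' \<Longrightarrow> cl (f + g) = cl (f' + g')"
  by (metis dan_alg_simps(2))

lemma cl_mult_cong: "cl f = cl f' \<Longrightarrow> cl g = cl g' \<Longrightarrow> cl (f * g) = cl (f' * g')"
  by (metis dan_alg_simps(3))

lemma cl_relation: "cl [:q:] = cl ([:[:c:]:] * [:0, 1:])"
proof -
  have "[:q:] - [:[:c:]:] * [:0, 1:] = (-1) * ([:[:c:]:] * [:0, 1:] - [:q:])" by simp
  then show ?thesis unfolding dan_cls_eq_iff dan_ideal_eq by blast
qed

text \<open>Division by \<open>q\<close>, with each occurrence of \<open>q\<close> replaced by \<open>c z\<close>.\<close>

lemma normal_form_const: "\<exists>N. is_normal N \<and> cl [:a:] = cl N"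
proof (induction "degree a" arbitrary: a rule: less_induct)
  case less
  show ?case
  proof (cases "degree a < degree q")
    case True then show ?thesis using normal_const by blast
  next
    case False
    obtain u where u: "u \<noteq> 0" "lead_coeff q = [:u:]" using quasi_monic by (auto simp: quasi_monic_def)
    define s where "s = monom (smult (inverse u) (lead_coeff a)) (degree a - degree q)"
    define r where "r = a - s * q"
    have "degree s \<le> degree a - degree q" by (simp add: s_def degree_monom_le)
    then have s: "degree s < degree a" and sq: "degree (s * q) \<le> degree a"
      using False degree_q degree_mult_le[of s q] by linarith+
    have "Polynomial.coeff (s * q) (degree a) = lead_coeff a"
      using False u unfolding s_def coeff_monom_mult by simp
    then have "Polynomial.coeff r (degree a) = 0" by (simp add: r_def)
    moreover have "degree r \<le> degree a" using sq by (simp add: r_def degree_diff_le)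
    ultimately have "degree r < degree a \<or> r = 0"
      by (metis le_neq_implies_less leading_coeff_0_iff)
    then have r: "degree r < degree a" using False degree_q by auto
    obtain M where M: "is_normal M" "cl [:s:] = cl M" using less[OF s] by blast
    obtain N where N: "is_normal N" "cl [:r:] = cl N" using less[OF r] by blast
    have "[:a:] = [:s:] * [:q:] + [:r:]" by (simp add: r_def)
    then have "cl [:a:] = cl (M * ([:[:c:]:] * [:0, 1:]) + N)"
      by (metis M(2) N(2) cl_add_cong cl_mult_cong cl_relation)
    moreover have "M * ([:[:c:]:] * [:0, 1:]) + N = smult [:c:] (pCons 0 M) + N" by simp
    ultimately show ?thesis
      using normal_add[OF normal_smult[OF normal_shift[OF M(1)]] N(1)] by metis
  qed
qed

lemma normal_form: "\<exists>N. is_normal N \<and> cl f = cl N"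
proof (induction f)
  case 0
  have "is_normal 0" using degree_q by (simp add: is_normal_def)
  then show ?case by blast
next
  case (pCons a f)
  obtain M where M: "is_normal M" "cl [:a:] = cl M" using normal_form_const by blast
  obtain N where N: "is_normal N" "cl f = cl N" using pCons.IH by blast
  have "pCons a f = [:a:] + [:0, 1:] * f" by simp
  then have "cl (pCons a f) = cl (M + [:0, 1:] * N)"
    by (metis M(2) N(2) cl_add_cong cl_mult_cong)
  also have "M + [:0, 1:] * N = M + pCons 0 N" by simp
  finally show ?case using normal_add[OF M(1) normal_shift[OF N(1)]] by blast
qed

text \<open>
  Multiplication by \<open>q/c\<close> raises the degree by \<open>degree q\<close>, past every coefficient that may
  be added; hence a nonzero coefficient of a positive power of \<open>z\<close> pushes the degree to at
  least \<open>degree q\<close>.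
\<close>

lemma localize_normal:
  assumes "is_normal N"
  shows "(localize c q N = 0 \<longrightarrow> N = 0) \<and> (degree (localize c q N) < degree q \<longrightarrow> (\<exists>r. N = [:r:]))"
  using assms
proof (induction N)
  case 0 then show ?case by (auto intro: exI[of _ 0])
next
  case (pCons r N)
  let ?Z = "smult (inverse (to_fract c)) (fract_poly q)"
  show ?case
  proof (cases "N = 0")
    case True
    then show ?thesis using pCons.hyps by (simp add: fract_poly_eq_0_iff)
  next
    case False
    have n: "degree r < degree q" "is_normal N" using pCons.prems by (auto simp: normal_pCons)
    then have nz: "localize c q N \<noteq> 0" using pCons.IH False by blast
    moreover have "?Z \<noteq> 0" and Zdeg: "degree ?Z = degree q" using c_nonzero degree_q by (auto simp: degree_map_poly)
    ultimately have big: "degree (?Z * localize c q N) \<ge> degree q"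
      by (metis degree_mult_eq le_add1)
    then have "degree (fract_poly r) < degree (?Z * localize c q N)"
      using n(1) by (simp add: degree_map_poly del: degree_smult_eq mult_smult_left)
    then have "degree (fract_poly r + ?Z * localize c q N) = degree (?Z * localize c q N)"
      by (rule degree_add_eq_right)
    then have "degree (localize c q (pCons r N)) \<ge> degree q"
      using big by (simp add: localize_pCons)
    then show ?thesis using degree_q by auto
  qed
qed

text \<open>
  This is where elements of the algebra differ from arbitrary elements of \<open>K[Y]\<close>: in low degree
  their coefficients are polynomials in \<open>x\<close>.
\<close>

lemma emb_low_degree:
  assumes "a \<in> carrier A" "degree (emb a) < degree q"
  obtains r where "a = cl [:r:]" "emb a = fract_poly r"
proof -
  obtain f where "a = cl f" using assms(1) by (rule carrier_cases)
  then obtain N where N: "is_normal N" "a = cl N" using normal_form by metis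
  then obtain r where "N = [:r:]" using localize_normal[OF N(1)] assms(2) by (auto simp: emb_cl)
  then show ?thesis using that N by (simp add: emb_cl)
qed

lemma emb_eq_0:
  assumes "a \<in> carrier A" "emb a = 0" shows "a = \<zero>\<^bsub>A\<^esub>"
proof -
  obtain f where "a = cl f" using assms(1) by (rule carrier_cases)
  then obtain N where N: "is_normal N" "a = cl N" using normal_form by metis
  then have "N = 0" using localize_normal[OF N(1)] assms(2) by (auto simp: emb_cl)
  then show ?thesis using N by (simp add: dan_alg_simps)
qed

lemma emb_inj: 
  assumes a: "a \<in> carrier A" and b: "b \<in> carrier A" and eq: "emb a = emb b"
  shows "a = b"
proof -
  obtain f g where fg: "a = cl f" "b = cl g" using a b by (metis carrier_cases)
  have "emb (cl (f - g)) + emb b = emb a" by (simp add: fg emb_cl flip: localize_add)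
  then have "cl (f - g) = cl 0" using emb_eq_0[of "cl (f - g)"] eq by (simp add: dan_alg_simps)
  then show ?thesis by (simp add: fg dan_cls_eq_iff)
qed

lemma emb_finsum:
  assumes "finite K" "\<And>k. k \<in> K \<Longrightarrow> h k \<in> carrier A"
  shows "emb (\<Oplus>\<^bsub>A\<^esub>k\<in>K. h k) = (\<Sum>k\<in>K. emb (h k))"
  using assms by (induction K) (auto simp: emb_zero emb_add Pi_def)


section \<open>Derivations and exponentials seen in the embedding\<close>

lemma Der_closed: "E \<in> Der A \<Longrightarrow> a \<in> carrier A \<Longrightarrow> E a \<in> carrier A"
  unfolding Der_def mem_Collect_eq by (elim conjE PiE_mem)

lemma Der_add:
  assumes "E \<in> Der A" "a \<in> carrier A" "b \<in> carrier A"
  shows "E (a \<oplus>\<^bsub>A\<^esub> b) = E a \<oplus>\<^bsub>A\<^esub> E b"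
  using assms(1)[unfolded Der_def mem_Collect_eq, THEN conjunct2, THEN conjunct1] assms(2,3) by metis

lemma Der_scale:
  assumes "E \<in> Der A" "a \<in> carrier A"
  shows "E (t \<odot>\<^bsub>A\<^esub> a) = t \<odot>\<^bsub>A\<^esub> E a"
  using assms(1)[unfolded Der_def mem_Collect_eq, THEN conjunct2, THEN conjunct2, THEN conjunct1]
    assms(2) by metis

lemma Der_mult:
  assumes "E \<in> Der A" "a \<in> carrier A" "b \<in> carrier A"
  shows "E (a \<otimes>\<^bsub>A\<^esub> b) = (E a \<otimes>\<^bsub>A\<^esub> b) \<oplus>\<^bsub>A\<^esub> (a \<otimes>\<^bsub>A\<^esub> E b)"
  using assms(1)[unfolded Der_def mem_Collect_eq, THEN conjunct2, THEN conjunct2, THEN conjunct2]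
    assms(2,3) by metis

lemma emb_Der_add:
  assumes "E \<in> Der A"
  shows "emb (E (cl (f + g))) = emb (E (cl f)) + emb (E (cl g))"
  using Der_add[OF assms cl_closed cl_closed, of f g]
  by (simp only: dan_alg_simps(2) emb_add Der_closed[OF assms] cl_closed)

lemma emb_Der_mult:
  assumes "E \<in> Der A"
  shows "emb (E (cl (f * g))) = emb (E (cl f)) * localize c q g + localize c q f * emb (E (cl g))"
  using Der_mult[OF assms cl_closed cl_closed, of f g]
  by (simp only: dan_alg_simps(3) emb_add emb_mult emb_cl Der_closed[OF assms] cl_closed A.m_closed)

lemma emb_Der_const:
  assumes "E \<in> Der A"
  shows "emb (E (cl [:[:[:t:]:]:])) = 0"
proof -
  have "localize c q 1 = 1" using localize_const[of c q 1] by (simp only: fract_poly_1 flip: one_pCons)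
  then have "emb (E (cl 1)) = emb (E (cl 1)) + emb (E (cl 1))"
    using emb_Der_mult[OF assms, of 1 1] by (simp only: mult_1_left mult_1_right)
  then have "emb (E (cl 1)) = 0" by (metis add_cancel_right_right)
  moreover have "E (t \<odot>\<^bsub>A\<^esub> cl 1) = t \<odot>\<^bsub>A\<^esub> E (cl 1)"
    by (rule Der_scale[OF assms cl_closed])
  ultimately have "emb (E (t \<odot>\<^bsub>A\<^esub> cl 1)) = 0"
    using Der_closed[OF assms cl_closed[of 1]] by (simp only: emb_scale smult_0_right)
  then show ?thesis by (simp only: dan_alg_simps(6) mult_1_right)
qed

text \<open>The chain rule on the subring generated by \<open>x\<close>.\<close>

lemma emb_Der_kx:
  assumes "E \<in> Der A"
  shows "emb (E (cl [:[:s:]:])) = smult (to_fract (pderiv s)) (emb (E (dan_x c q)))"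
proof (induction s)
  case 0 then show ?case using emb_Der_const[OF assms, of 0] by simp
next
  case (pCons a s)
  have "[:[:pCons a s:]:] = [:[:[:a:]:]:] + [:[:[:0, 1:]:]:] * [:[:s:]:]" by simp
  then have "emb (E (cl [:[:pCons a s:]:])) = emb (E (cl ([:[:[:a:]:]:] + [:[:[:0, 1:]:]:] * [:[:s:]:])))"
    by metis
  also have "\<dots> = emb (E (dan_x c q)) * [:to_fract s:] + [:to_fract [:0, 1:]:] * emb (E (cl [:[:s:]:]))"
    by (simp only: emb_Der_add[OF assms] emb_Der_mult[OF assms] emb_Der_const[OF assms])
      (simp add: map_poly_pCons dan_x_def)
  also have "\<dots> = smult (to_fract (pderiv (pCons a s))) (emb (E (dan_x c q)))"
  proof -
    have "pderiv (pCons a s) = s + [:0, 1:] * pderiv s" by (simp add: pderiv_pCons)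
    then show ?thesis unfolding pCons.IH
      by (simp only: to_fract_add to_fract_mult smult_add_left) (simp add: mult.commute)
  qed
  finally show ?case .
qed

lemma pderiv_fract_poly: "pderiv (fract_poly p) = fract_poly (pderiv p)" for p :: "'k poly poly"
proof -
  have "to_fract (of_nat n :: 'k poly) = of_nat n" for n by (induction n) simp_all
  then show ?thesis by (intro poly_eqI) (simp add: coeff_pderiv coeff_map_poly del: of_nat_Suc)
qed

lemma std_lnd: "is_std_lnd c q (std_lnd c q)"
  unfolding std_lnd_def by (rule theI'[OF ex1_std_lnd])

lemmas std_lnd_Der = std_lnd[unfolded is_std_lnd_def, THEN conjunct1]

lemma emb_std_lnd_cl: "emb (std_lnd c q (cl f)) = smult (to_fract c) (pderiv (localize c q f))"
proof (induction f rule: poly3_induct)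
  case (const t)
  then show ?case by (simp add: emb_Der_const[OF std_lnd_Der] map_poly_pCons)
next
  case x
  then show ?case using std_lnd by (simp add: is_std_lnd_def dan_x_def emb_zero map_poly_pCons)
next
  case y
  then show ?case using std_lnd
    by (simp add: is_std_lnd_def dan_y_def emb_cl map_poly_pCons pderiv_pCons)
next
  case z
  then show ?case using std_lnd c_nonzero
    by (simp add: is_std_lnd_def dan_z_def emb_cl localize_pCons pderiv_smult pderiv_fract_poly)
next
  case (add f g)
  then show ?case by (simp add: emb_Der_add[OF std_lnd_Der] localize_add pderiv_add smult_add_right)
next
  case (mult f g)
  then show ?case
    by (simp add: emb_Der_mult[OF std_lnd_Der] localize_mult pderiv_mult smult_add_right algebra_simps)
qed

lemma emb_std_lnd: "a \<in> carrier A \<Longrightarrow> emb (std_lnd c q a) = smult (to_fract c) (pderiv (emb a))"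
  by (elim carrier_cases) (simp add: emb_std_lnd_cl emb_cl)

definition scaled_lnd where
  "scaled_lnd l = (\<lambda>a\<in>carrier A. cl [:[:l:]:] \<otimes>\<^bsub>A\<^esub> std_lnd c q a)"

lemma scaled_lnd_closed: "a \<in> carrier A \<Longrightarrow> scaled_lnd l a \<in> carrier A"
  by (simp add: scaled_lnd_def Der_closed[OF std_lnd_Der])

lemma emb_scaled_lnd:
  "a \<in> carrier A \<Longrightarrow> emb (scaled_lnd l a) = smult (to_fract (l * c)) (pderiv (emb a))"
  by (simp add: scaled_lnd_def Der_closed[OF std_lnd_Der] emb_mult emb_cl emb_std_lnd map_poly_pCons mult.commute)

lemma scaled_lnd_power:
  assumes "a \<in> carrier A"
  shows "(scaled_lnd l ^^ k) a \<in> carrier A \<and>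
    emb ((scaled_lnd l ^^ k) a) = smult (to_fract (l * c) ^ k) ((pderiv ^^ k) (emb a))"
  using assms by (induction k) (simp_all add: scaled_lnd_closed emb_scaled_lnd pderiv_smult)

text \<open>
  The powers of the derivation act as \<open>(l c)\<^sup>k (\<partial>/\<partial>Y)\<^sup>k\<close>, so the exponential series is the
  Taylor expansion. Injectivity of the embedding gives local nilpotency and hence the
  finiteness of the index set of the sum.
\<close>

lemma exp_scaled_lnd:
  assumes a: "a \<in> carrier A"
  shows "exp_der A (scaled_lnd l) a \<in> carrier A"
    and "emb (exp_der A (scaled_lnd l) a) = taylor_shift (to_fract (l * c)) (emb a)"
proof -
  let ?p = "\<lambda>k. (scaled_lnd l ^^ k) a"
  let ?K = "{k. ?p k \<noteq> \<zero>\<^bsub>A\<^esub>}"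
  let ?g = "\<lambda>k. smult (to_fract [:1 / fact k:] * to_fract (l * c) ^ k) ((pderiv ^^ k) (emb a))"
  note p = scaled_lnd_power[OF a, where l = l]
  have sub: "?K \<subseteq> {..degree (emb a)}"
  proof
    fix k assume "k \<in> ?K"
    then have "?p k \<noteq> \<zero>\<^bsub>A\<^esub>" by simp
    then have "(pderiv ^^ k) (emb a) \<noteq> 0" using p[of k] emb_eq_0 by fastforce
    then show "k \<in> {..degree (emb a)}" using higher_pderiv_eq_0[of "emb a" k]
      by (metis atMost_iff not_le)
  qed
  then have fin: "finite ?K" by (rule finite_subset) simp
  have term_closed: "(1 / fact k) \<odot>\<^bsub>A\<^esub> ?p k \<in> carrier A" for k
    using p[of k] by (blast intro: scale_closed)
  have ex: "exp_der A (scaled_lnd l) a = (\<Oplus>\<^bsub>A\<^esub>k\<in>?K. (1 / fact k) \<odot>\<^bsub>A\<^esub> ?p k)"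
    using a by (simp add: exp_der_def)
  show "exp_der A (scaled_lnd l) a \<in> carrier A" unfolding ex using term_closed by (intro A.finsum_closed) auto
  have "emb (exp_der A (scaled_lnd l) a) = (\<Sum>k\<in>?K. emb ((1 / fact k) \<odot>\<^bsub>A\<^esub> ?p k))"
    unfolding ex using fin term_closed by (intro emb_finsum)
  also have "\<dots> = (\<Sum>k\<in>?K. ?g k)"
    using p by (intro sum.cong) (auto simp: emb_scale)
  also have "\<dots> = (\<Sum>k\<le>degree (emb a). ?g k)"
  proof (rule sum.mono_neutral_left[OF finite_atMost sub], rule ballI)
    fix k assume "k \<in> {..degree (emb a)} - ?K"
    then have "?p k = \<zero>\<^bsub>A\<^esub>" by blast
    then have "smult (to_fract (l * c) ^ k) ((pderiv ^^ k) (emb a)) = 0"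
      using p[of k] by (metis emb_zero)
    then show "?g k = 0" by (metis smult_0_right smult_smult)
  qed
  finally show "emb (exp_der A (scaled_lnd l) a) = taylor_shift (to_fract (l * c)) (emb a)"
    by (simp add: taylor_shift_def)
qed

lemma exp_scaled_lnd_0: "exp_der A (scaled_lnd 0) = (\<lambda>a\<in>carrier A. a)"
proof
  fix a show "exp_der A (scaled_lnd 0) a = (\<lambda>a\<in>carrier A. a) a"
  proof (cases "a \<in> carrier A")
    case True
    then have "exp_der A (scaled_lnd 0) a = a"
      using exp_scaled_lnd[OF True, of 0] by (intro emb_inj) (simp_all add: taylor_shift_0)
    then show ?thesis using True by simp
  next
    case False then show ?thesis by (simp add: exp_der_def)
  qed
qed


section \<open>Simple derivations\<close>

text \<open>An inverse of \<open>x - r\<close> would have degree zero in \<open>Y\<close>, hence lie in \<open>k[x]\<close>.\<close>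

lemma linear_not_unit:
  assumes "b \<in> carrier A" shows "b \<otimes>\<^bsub>A\<^esub> cl [:[:[:- r, 1:]:]:] \<noteq> \<one>\<^bsub>A\<^esub>"
proof
  assume "b \<otimes>\<^bsub>A\<^esub> cl [:[:[:- r, 1:]:]:] = \<one>\<^bsub>A\<^esub>"
  then have eq: "emb b * [:to_fract [:- r, 1:]:] = 1"
    using assms emb_mult[of b "cl [:[:[:- r, 1:]:]:]"] localize_const[of c q 1, folded one_pCons]
    by (simp add: dan_alg_simps(5) emb_cl map_poly_pCons)
  then have nz: "emb b \<noteq> 0" by auto
  have "degree (emb b * [:to_fract [:- r, 1:]:]) = 0" using eq by simp
  then have deg: "degree (emb b) = 0" using nz by (simp add: degree_mult_eq)
  then obtain s where s: "emb b = fract_poly s" using emb_low_degree[OF assms] degree_q by auto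
  then have "degree s = 0" using deg by (simp add: degree_map_poly)
  then obtain u where "s = [:u:]" by (rule degree_eq_zeroE)
  then have "to_fract (u * [:- r, 1:]) = to_fract 1"
    using eq s unfolding to_fract_mult by (simp add: map_poly_pCons one_pCons mult_ac del: to_fract_const_1)
      (simp flip: one_pCons)
  then have "[:- r, 1:] dvd 1" unfolding to_fract_eq_iff by (metis dvd_triv_right)
  then show False by (simp add: is_unit_iff_degree)
qed

text \<open>At a root \<open>r\<close> of \<open>p\<close>, the element \<open>x - r\<close> divides its own derivative, which is \<open>p\<close>.\<close>

lemma simple_derivation_x:
  assumes simple: "simple_derivation A D" and Dx: "D (dan_x c q) = cl [:[:p:]:]"
  shows "poly p r \<noteq> 0"
proof
  assume "poly p r = 0"
  then obtain s where s: "p = [:- r, 1:] * s" by (metis poly_eq_0_iff_dvd dvdE)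
  let ?w = "cl [:[:[:- r, 1:]:]:]"
  let ?I = "PIdl\<^bsub>A\<^esub> ?w"
  have D: "D \<in> Der A" using simple by (simp add: simple_derivation_def)
  have Dw: "D ?w = cl [:[:s:]:] \<otimes>\<^bsub>A\<^esub> ?w"
  proof (rule emb_inj)
    have "emb (D ?w) = [:to_fract p:]"
      using emb_Der_kx[OF D, of "[:- r, 1:]"] by (simp add: pderiv_pCons Dx emb_cl map_poly_pCons)
    then show "emb (D ?w) = emb (cl [:[:s:]:] \<otimes>\<^bsub>A\<^esub> ?w)"
      unfolding s to_fract_mult by (simp add: emb_mult emb_cl map_poly_pCons mult_ac)
  qed (simp_all add: Der_closed[OF D])
  have "D ` ?I \<subseteq> ?I"
  proof safe
    fix a assume "a \<in> ?I"
    then obtain b where b: "b \<in> carrier A" "a = b \<otimes>\<^bsub>A\<^esub> ?w" by (auto simp: cgenideal_def)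
    have "D a = (D b \<otimes>\<^bsub>A\<^esub> ?w) \<oplus>\<^bsub>A\<^esub> (b \<otimes>\<^bsub>A\<^esub> D ?w)"
      unfolding b(2) by (rule Der_mult[OF D b(1) cl_closed])
    also have "\<dots> = (D b \<oplus>\<^bsub>A\<^esub> (b \<otimes>\<^bsub>A\<^esub> cl [:[:s:]:])) \<otimes>\<^bsub>A\<^esub> ?w"
      using b Der_closed[OF D b(1)] by (simp add: Dw A.l_distr A.m_assoc)
    finally show "D a \<in> ?I" using b Der_closed[OF D b(1)] unfolding cgenideal_def by auto
  qed
  moreover have "ideal ?I A" by (rule A.cgenideal_ideal) simp
  ultimately have "?I = {\<zero>\<^bsub>A\<^esub>} \<or> ?I = carrier A"
    using simple unfolding simple_derivation_def by blast
  moreover have "?w \<in> ?I" by (rule A.cgenideal_self) simp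
  moreover have "?w \<noteq> \<zero>\<^bsub>A\<^esub>"
  proof
    assume "?w = \<zero>\<^bsub>A\<^esub>"
    then have "emb ?w = 0" by (simp add: emb_zero)
    then show False by (simp add: emb_cl)
  qed
  moreover have "\<one>\<^bsub>A\<^esub> \<notin> ?I" using linear_not_unit by (auto simp: cgenideal_def)
  ultimately show False by auto
qed

lemma id_in_Aut_Der:
  assumes "E \<in> Der A" shows "(\<lambda>a\<in>carrier A. a) \<in> Aut_Der A E"
proof -
  let ?id = "\<lambda>a\<in>carrier A. a"
  have "?id \<in> ring_hom A A" by (rule ring_hom_memI) simp_all
  moreover have "?id (t \<odot>\<^bsub>A\<^esub> a) = t \<odot>\<^bsub>A\<^esub> ?id a" if "a \<in> carrier A" for t a
    using that by (simp add: scale_closed)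
  moreover have "compose (carrier A) ?id E = compose (carrier A) E ?id"
    using Der_closed[OF assms] by (auto simp: compose_def fun_eq_iff restrict_def)
  ultimately show ?thesis unfolding Aut_Der_def Alg_Aut_def using id_Bij by blast
qed

end


section \<open>Exponentials commuting with a simple derivation\<close>

theorem proposition7:
  fixes c :: "'k::{alg_closed_field, field_char_0} poly"
    and q :: "'k poly poly"
    and D :: "'k poly poly poly set \<Rightarrow> 'k poly poly poly set"
  assumes "quasi_monic q"
    and "reduced_form c q"
    and "degree c \<ge> 2"
    and "degree q \<ge> 2"
    and "D \<in> Der (dan_alg c q)"
    and "simple_derivation (dan_alg c q) D"
  shows "Aut_Der (dan_alg c q) D \<inter> dan_U c q = {\<lambda>a\<in>carrier (dan_alg c q). a}"
proof -
  interpret danielewski c q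
    using assms by unfold_locales auto
  note D = \<open>D \<in> Der A\<close>
  have U: "dan_U c q = range (\<lambda>l. exp_der A (scaled_lnd l))"
    by (auto simp: dan_U_def scaled_lnd_def)
  have trivial: "l = 0" if aut: "exp_der A (scaled_lnd l) \<in> Aut_Der A D" for l
  proof (rule ccontr)
    assume "l \<noteq> 0"
    define s where "s = l * c"
    define \<sigma> where "\<sigma> = exp_der A (scaled_lnd l)"
    have s: "s \<noteq> 0" "degree s > 0"
      using \<open>l \<noteq> 0\<close> \<open>degree c \<ge> 2\<close> c_nonzero by (auto simp: s_def degree_mult_eq)
    have emb_\<sigma>: "emb (\<sigma> a) = taylor_shift (to_fract s) (emb a)" and \<sigma>_closed: "\<sigma> a \<in> carrier A"
      if "a \<in> carrier A" for a
      using exp_scaled_lnd[OF that, of l] by (simp_all add: \<sigma>_def s_def)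
    have comm: "\<sigma> (D a) = D (\<sigma> a)" if "a \<in> carrier A" for a
    proof -
      have "compose (carrier A) \<sigma> D a = compose (carrier A) D \<sigma> a"
        using aut by (simp add: Aut_Der_def \<sigma>_def)
      then show ?thesis using that by (simp add: compose_def)
    qed
    have x: "dan_x c q \<in> carrier A" and y: "dan_y c q \<in> carrier A"
      by (simp_all add: dan_x_def dan_y_def)
    have "\<sigma> (dan_x c q) = dan_x c q"
      using x by (intro emb_inj)
        (simp_all add: emb_\<sigma> \<sigma>_closed dan_x_def emb_cl taylor_shift_const map_poly_pCons)
    then have "taylor_shift (to_fract s) (emb (D (dan_x c q))) = emb (D (dan_x c q))"
      using comm[OF x] emb_\<sigma>[OF Der_closed[OF D x]] by simp
    then have deg0: "degree (emb (D (dan_x c q))) = 0"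
      using s by (intro degree_taylor_shift_fixed) auto
    then obtain r where r: "D (dan_x c q) = cl [:r:]" "emb (D (dan_x c q)) = fract_poly r"
      using emb_low_degree[OF Der_closed[OF D x]] degree_q by auto
    then have "degree r = 0" using deg0 by (simp add: degree_map_poly)
    then obtain p where "r = [:p:]" by (rule degree_eq_zeroE)
    then have Dx: "D (dan_x c q) = cl [:[:p:]:]" using r by simp
    have noroot: "poly p a \<noteq> 0" for a
      using simple_derivation_x[OF \<open>simple_derivation A D\<close> Dx] .
    then have "degree p = 0" using alg_closed_imp_poly_has_root[of p] by auto
    then obtain \<mu> where p: "p = [:\<mu>:]" by (rule degree_eq_zeroE)
    with noroot[of 0] have "\<mu> \<noteq> 0" by simp
    have \<sigma>y: "\<sigma> (dan_y c q) = cl ([:[:0, 1:]:] + [:[:s:]:])"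
      using y by (intro emb_inj)
        (simp_all add: emb_\<sigma> \<sigma>_closed dan_y_def emb_cl taylor_shift_def map_poly_pCons pderiv_pCons)
    let ?g = "emb (D (dan_y c q))"
    have "taylor_shift (to_fract s) ?g = emb (D (\<sigma> (dan_y c q)))"
      using comm[OF y] emb_\<sigma>[OF Der_closed[OF D y]] by simp
    also have "\<dots> = ?g + emb (D (cl [:[:s:]:]))"
      unfolding \<sigma>y emb_Der_add[OF D] by (simp add: dan_y_def)
    also have "emb (D (cl [:[:s:]:])) = [:to_fract (pderiv s * [:\<mu>:]):]"
      unfolding emb_Der_kx[OF D] Dx emb_cl p localize_const to_fract_mult by (simp add: map_poly_pCons)
    finally have shift: "taylor_shift (to_fract s) ?g = ?g + [:to_fract (pderiv s * [:\<mu>:]):]" .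
    have ds: "pderiv s * [:\<mu>:] \<noteq> 0" using s \<open>\<mu> \<noteq> 0\<close> by (simp add: pderiv_eq_0_iff)
    have g: "degree ?g = 1" "to_fract s * Polynomial.coeff ?g 1 = to_fract (pderiv s * [:\<mu>:])"
      using taylor_shift_translated[OF _ _ shift] s ds by auto
    then have "degree ?g < degree q" using \<open>degree q \<ge> 2\<close> by simp
    then obtain h where "?g = fract_poly h" using emb_low_degree[OF Der_closed[OF D y]] by blast
    then have "to_fract (s * Polynomial.coeff h 1) = to_fract (pderiv s * [:\<mu>:])"
      using g(2) unfolding to_fract_mult by (simp add: coeff_map_poly)
    then have eq: "s * Polynomial.coeff h 1 = pderiv s * [:\<mu>:]" unfolding to_fract_eq_iff .
    then have "degree s \<le> degree (pderiv s * [:\<mu>:])" using ds by (metis dvd_imp_degree_le dvd_triv_left)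
    also have "\<dots> \<le> degree s - 1" by (simp add: degree_pderiv)
    finally show False using s by simp
  qed
  show ?thesis
  proof (intro equalityI subsetI)
    fix \<sigma> assume "\<sigma> \<in> Aut_Der A D \<inter> dan_U c q"
    then show "\<sigma> \<in> {\<lambda>a\<in>carrier A. a}" using trivial exp_scaled_lnd_0 by (auto simp: U)
  next
    fix \<sigma> assume "\<sigma> \<in> {\<lambda>a\<in>carrier A. a}"
    then show "\<sigma> \<in> Aut_Der A D \<inter> dan_U c q"
      using id_in_Aut_Der[OF D] exp_scaled_lnd_0 unfolding U by (metis IntI rangeI singletonD)
  qed
qed

end
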